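(* Let $\kappa_1,\kappa_2\in\mathbb{R}$ and let $\mathcal{T}_{\kappa_1\kappa_2}:\mathbb{T}\times\mathbb{R}\to\mathbb{T}\times\mathbb{R}$ be the map $\mathcal{T}_{\kappa_1\kappa_2}=\mathcal{S}_{\kappa_2}\circ\mathcal{S}_{\kappa_1}$, where $\mathcal{S}_\epsilon(x,y)=\left(x+y+\frac{\epsilon}{2\pi}\sin(2\pi x),\; y+\frac{\epsilon}{2\pi}\sin(2\pi x)\right)$ with the first coordinate taken mod $1$. Write $(x_n,y_n)=\mathcal{T}_{\kappa_1\kappa_2}^n(x_0,y_0)$. Suppose that there is an initial condition $(x_0,y_0)$ with $y_0\in(0,1)$ for which $|y_n-y_0|>2$ for some $n$, and that all the invariant circles of $\mathcal{T}_{\kappa_1\kappa_2}$ have amplitude $\mathcal{A}<1$. Then $\mathcal{T}_{\kappa_1\kappa_2}$ has global transport.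
   Context: Here $\mathbb{T}=\mathbb{R}/\mathbb{Z}$. An invariant circle means an invariant circle of the map in the cylinder $\mathbb{T}\times\mathbb{R}$ that is not homotopic to a point, i.e. one that goes around the cylinder. The amplitude $\mathcal{A}$ of an invariant circle is the difference between the $y$-coordinates of its highest and lowest points. The map has global transport if there exists at least one initial condition $(x_0,y_0)$ for which the $y$ variable is unbounded along its orbit, i.e. the sequence $(y_n)$ is unbounded. *)

theory Defs
  imports "HOL-Analysis.Analysis"
begin

quotient_type circle = real / "\<lambda>x y :: real. x - y \<in> \<int>"
proof (rule equivpI)
  show "reflp (\<lambda>x y :: real. x - y \<in> \<int>)"
    by (simp add: reflp_def)
  show "symp (\<lambda>x y :: real. x - y \<in> \<int>)"
    by (metis (no_types, lifting) Ints_minus minus_diff_eq sympI)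
  show "transp (\<lambda>x y :: real. x - y \<in> \<int>)"
    by (metis (no_types, lifting) Ints_add diff_add_cancel add_diff_eq transpI)
qed

instantiation circle :: topological_space
begin

definition open_circle :: "circle set \<Rightarrow> bool" where
  "open_circle U \<longleftrightarrow> open (abs_circle -` U)"

instance
proof
  show "open (UNIV :: circle set)"
    by (simp add: open_circle_def)
  show "open (S \<inter> T)" if "open S" "open T" for S T :: "circle set"
    using that by (simp add: open_circle_def vimage_Int open_Int)
  show "open (\<Union>K)" if "\<forall>S\<in>K. open S" for K :: "circle set set"
    using that by (auto simp: open_circle_def vimage_Union)
qed

end

lift_definition std_map :: "real \<Rightarrow> circle \<times> real \<Rightarrow> circle \<times> real"
  is "\<lambda>\<epsilon> (x, y). (x + y + \<epsilon> / (2 * pi) * sin (2 * pi * x),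
                   y + \<epsilon> / (2 * pi) * sin (2 * pi * x))"
proof -
  fix \<epsilon> :: real and p q :: "real \<times> real"
  assume "rel_prod (\<lambda>x y. x - y \<in> \<int>) (=) p q"
  then obtain x x' y where pq: "p = (x, y)" "q = (x', y)" and "x - x' \<in> \<int>"
    by (cases p; cases q) auto
  then obtain k where k: "x = x' + of_int k"
    by (metis Ints_cases add.commute diff_add_cancel)
  have "sin (2 * pi * x) = sin (2 * pi * x')"
    unfolding k distrib_left by (simp add: sin_add sin_int_2pin cos_int_2pin)
  with \<open>x - x' \<in> \<int>\<close> show "rel_prod (\<lambda>x y. x - y \<in> \<int>) (=)
      (case p of (x, y) \<Rightarrow> (x + y + \<epsilon> / (2 * pi) * sin (2 * pi * x),
                             y + \<epsilon> / (2 * pi) * sin (2 * pi * x)))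
      (case q of (x, y) \<Rightarrow> (x + y + \<epsilon> / (2 * pi) * sin (2 * pi * x),
                             y + \<epsilon> / (2 * pi) * sin (2 * pi * x)))"
    by (simp add: pq)
qed

lemma std_map_abs_circle:
  "std_map \<epsilon> (abs_circle x, y) =
     (abs_circle (x + y + \<epsilon> / (2 * pi) * sin (2 * pi * x)),
      y + \<epsilon> / (2 * pi) * sin (2 * pi * x))"
  using std_map.abs_eq[of \<epsilon> "(x, y)"] by simp

definition two_kick_map :: "real \<Rightarrow> real \<Rightarrow> circle \<times> real \<Rightarrow> circle \<times> real" where
  "two_kick_map \<kappa>\<^sub>1 \<kappa>\<^sub>2 = std_map \<kappa>\<^sub>2 \<circ> std_map \<kappa>\<^sub>1"

text \<open>An invariant circle is a topologically embedded circle, given as the image of a simple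
  closed path; since the homotopy of loops is free, ``not homotopic to a point'' means that the
  curve goes around the cylinder.\<close>

definition invariant_circle :: "(circle \<times> real \<Rightarrow> circle \<times> real) \<Rightarrow> (circle \<times> real) set \<Rightarrow> bool" where
  "invariant_circle F C \<longleftrightarrow> F ` C = C \<and>
     (\<exists>\<gamma>. simple_path \<gamma> \<and> pathfinish \<gamma> = pathstart \<gamma> \<and> path_image \<gamma> = C \<and>
          \<not> (\<exists>p. homotopic_loops UNIV \<gamma> (\<lambda>t. p)))"

text \<open>Meaningful for nonempty \<open>C\<close> with bounded \<open>y\<close>-coordinate; for the image of a path, the
  supremum and the infimum are attained.\<close>

definition amplitude :: "(circle \<times> real) set \<Rightarrow> real" where
  "amplitude C = Sup (snd ` C) - Inf (snd ` C)"

definition global_transport :: "(circle \<times> real \<Rightarrow> circle \<times> real) \<Rightarrow> bool" where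
  "global_transport F \<longleftrightarrow> (\<exists>p. \<not> bounded (range (\<lambda>n. snd ((F ^^ n) p))))"

end

theory Submission
  imports Defs
begin

text \<open>
  Lift an orbit to the line and forget the momenta: the positions after successive kicks form a
  sequence \<open>x\<close> with \<open>x n + x (n + 2) - 2 * x (n + 1) = f (n + 1) (x (n + 1))\<close>, where \<open>f n\<close> is the
  \<open>n\<close>-th kick, and the momenta are the increments of \<open>x\<close>. The left-hand side increases with the
  two neighbours of \<open>x (n + 1)\<close>, so this recurrence behaves like a discrete elliptic equation: between
  an ordered pair of a subsolution and a supersolution there is a solution (\<open>solution_between\<close>).
  An orbit of unbounded momentum is therefore found as soon as both barriers grow faster than
  linearly.

  The supersolution comes from the given orbit. Up to the symmetry \<open>x \<mapsto> - x\<close> its momentum rises by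
  more than 2. Repeat the rising piece over and over, each copy translated by integers so that its
  momentum is 1 higher than that of the copy before. At a junction the momentum then drops by at
  least 1. A copy can be placed, by an integer translation, at most 1 above the end of its
  predecessor; the drop makes it pass below the predecessor within one step. Replacing a sequence by
  a lower one at such a crossing keeps the supersolution inequality
  (\<open>accelerating_supersolution\<close>).

  The subsolution is elementary: kicks vanish at integers, so every convex sequence of integers is a
  subsolution, and one can be chosen with increments that grow just as fast as those guaranteed for
  the supersolution (\<open>accelerating_subsolution_below\<close>). A solution between the two cannot have
  bounded momentum, because it would then grow at most linearly (\<open>global_transport_of_rise\<close>).
\<close>

section \<open>Solutions between sub- and supersolutions\<close>

definition solves :: "(nat \<Rightarrow> real \<Rightarrow> real) \<Rightarrow> (nat \<Rightarrow> real) \<Rightarrow> bool" where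
  "solves f x \<longleftrightarrow> (\<forall>n. x n + x (n + 2) - 2 * x (n + 1) = f (n + 1) (x (n + 1)))"

text \<open>
  Solving the recurrence at \<open>n + 1\<close> for the middle term, after adding \<open>L\<close> times that term to both
  sides, turns solutions into fixed points of an order-preserving operator \<open>F\<close>; this is what the
  monotonicity hypothesis is for. The supremum of all post-fixed points between the barriers is a
  fixed point, as in the theorem of Knaster and Tarski.
\<close>

lemma solution_between:
  fixes f :: "nat \<Rightarrow> real \<Rightarrow> real" and u v :: "nat \<Rightarrow> real"
  assumes L: "L \<ge> 0" and mono: "\<And>n. mono (\<lambda>s. L * s - f n s)"
    and sub: "\<And>n. f (n + 1) (u (n + 1)) \<le> u n + u (n + 2) - 2 * u (n + 1)"
    and super: "\<And>n. v n + v (n + 2) - 2 * v (n + 1) \<le> f (n + 1) (v (n + 1))"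
    and le: "\<And>n. u n \<le> v n"
  obtains x where "solves f x" "\<And>n. u n \<le> x n" "\<And>n. x n \<le> v n"
proof -
  \<comment> \<open>The recurrence does not constrain the initial term; it is pinned to the upper barrier.\<close>
  define F where "F w n = (case n of 0 \<Rightarrow> v 0
      | Suc m \<Rightarrow> (w m + w (m + 2) + (L * w (m + 1) - f (m + 1) (w (m + 1)))) / (2 + L))"
    for w :: "nat \<Rightarrow> real" and n
  have F_mono: "F w n \<le> F w' n" if "\<And>n. w n \<le> w' n" for w w' n
    using that monoD[OF mono that]
    by (auto simp: F_def L intro!: divide_right_mono add_mono split: nat.split)
  have F_u: "u n \<le> F u n" for n
  proof (cases n)
    case (Suc m)
    then show ?thesis using sub[of m] L by (simp add: F_def field_simps)
  qed (use le in \<open>simp add: F_def\<close>)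
  have F_v: "F v n \<le> v n" for n
  proof (cases n)
    case (Suc m)
    then show ?thesis using super[of m] L by (simp add: F_def field_simps)
  qed (simp add: F_def)
  define W where "W = {w. \<forall>n. u n \<le> w n \<and> w n \<le> v n \<and> w n \<le> F w n}"
  define x where "x n = (SUP w\<in>W. w n)" for n
  have u_W: "u \<in> W"
    using le F_u by (simp add: W_def)
  have upper: "w n \<le> x n" if "w \<in> W" for w n
    unfolding x_def by (rule cSUP_upper[OF that bdd_aboveI[of _ "v n"]]) (auto simp: W_def)
  have least: "x n \<le> b" if "\<And>w. w \<in> W \<Longrightarrow> w n \<le> b" for b n
    unfolding x_def using u_W that by (intro cSUP_least) auto
  have ux: "u n \<le> x n" and xv: "x n \<le> v n" for n
    using upper[OF u_W] least[of n "v n"] by (auto simp: W_def)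
  have xF: "x n \<le> F x n" for n
  proof (rule least)
    fix w assume w: "w \<in> W"
    then have "w n \<le> F w n" by (simp add: W_def)
    also have "\<dots> \<le> F x n" by (rule F_mono) (rule upper[OF w])
    finally show "w n \<le> F x n" .
  qed
  have "u n \<le> F x n" "F x n \<le> v n" "F x n \<le> F (F x) n" for n
    using order_trans[OF ux xF] order_trans[OF F_mono F_v] xv F_mono[of x "F x"] xF by blast+
  then have "F x \<in> W"
    by (simp add: W_def)
  then have fixpoint: "F x n = x n" for n
    using upper xF by (meson order_antisym)
  have "x n + x (n + 2) - 2 * x (n + 1) = f (n + 1) (x (n + 1))" for n
    using fixpoint[of "Suc n"] L by (simp add: F_def field_simps)
  then have "solves f x"
    by (simp add: solves_def)
  from this ux xv show ?thesis by (rule that)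
qed

section \<open>Lifted orbits\<close>

definition kick :: "real \<Rightarrow> real \<Rightarrow> real" where
  "kick \<epsilon> s = \<epsilon> / (2 * pi) * sin (2 * pi * s)"

lemma kick_add_int: "kick \<epsilon> (s + of_int k) = kick \<epsilon> s"
  by (simp add: kick_def distrib_left sin_add sin_int_2pin cos_int_2pin)

lemma kick_int: "kick \<epsilon> (of_int k) = 0"
  by (simp add: kick_def sin_int_2pin)

lemma kick_uminus: "kick \<epsilon> (- s) = - kick \<epsilon> s"
  by (simp add: kick_def)

lemma abs_kick_le: "\<bar>kick \<epsilon> s\<bar> \<le> \<bar>\<epsilon>\<bar>"
proof -
  have "\<bar>\<epsilon>\<bar> * \<bar>sin (2 * pi * s)\<bar> \<le> \<bar>\<epsilon>\<bar> * (2 * pi)"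
    using order_trans[OF abs_sin_le_one[of "2 * pi * s"], of "2 * pi"] pi_gt3
    by (intro mult_left_mono) auto
  then show ?thesis
    by (simp add: kick_def abs_mult field_simps)
qed

lemma mono_minus_kick:
  assumes "\<bar>\<epsilon>\<bar> \<le> L"
  shows "mono (\<lambda>s. L * s - kick \<epsilon> s)"
proof (rule monoI)
  fix a b :: real
  assume "a \<le> b"
  then show "L * a - kick \<epsilon> a \<le> L * b - kick \<epsilon> b"
  proof (rule DERIV_nonneg_imp_nondecreasing)
    fix s :: real
    have "((\<lambda>s. L * s - kick \<epsilon> s) has_real_derivative L - \<epsilon> * cos (2 * pi * s)) (at s)"
      unfolding kick_def by (auto intro!: derivative_eq_intros)
    moreover have "\<epsilon> * cos (2 * pi * s) \<le> L"
      using mult_left_mono[OF abs_cos_le_one[of "2 * pi * s"], of "\<bar>\<epsilon>\<bar>"] assms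
        abs_ge_self[of "\<epsilon> * cos (2 * pi * s)"] by (simp add: abs_mult)
    ultimately show "\<exists>y. ((\<lambda>s. L * s - kick \<epsilon> s) has_real_derivative y) (at s) \<and> 0 \<le> y"
      by force
  qed
qed

text \<open>
  The recurrence first applies a kick at index 1, which has to be the kick of \<open>\<kappa>\<^sub>1\<close>; hence odd
  indices carry \<open>\<kappa>\<^sub>1\<close>.
\<close>

definition alternating_kick :: "real \<Rightarrow> real \<Rightarrow> nat \<Rightarrow> real \<Rightarrow> real" where
  "alternating_kick \<kappa>\<^sub>1 \<kappa>\<^sub>2 n = kick (if odd n then \<kappa>\<^sub>1 else \<kappa>\<^sub>2)"

lemma two_kick_map_lift:
  "two_kick_map \<kappa>\<^sub>1 \<kappa>\<^sub>2 (abs_circle s, y) =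
     (let y' = y + kick \<kappa>\<^sub>1 s; s' = s + y'; y'' = y' + kick \<kappa>\<^sub>2 s' in (abs_circle (s' + y''), y''))"
  by (simp add: two_kick_map_def std_map_abs_circle kick_def Let_def add.assoc)

text \<open>
  The dictionary between the two descriptions, used in both directions: to unfold the given orbit
  into a sequence, and to read off an orbit from the sequence found between the barriers. One step
  of the two-kick map advances the sequence by two indices.
\<close>

lemma orbit_of_solution:
  assumes "solves (alternating_kick \<kappa>\<^sub>1 \<kappa>\<^sub>2) x"
  shows "(two_kick_map \<kappa>\<^sub>1 \<kappa>\<^sub>2 ^^ n) (abs_circle (x 1), x 1 - x 0) =
     (abs_circle (x (2 * n + 1)), x (2 * n + 1) - x (2 * n))"
proof (induction n)
  case (Suc n)
  have 1: "x (2 * n + 2) = 2 * x (2 * n + 1) - x (2 * n) + kick \<kappa>\<^sub>1 (x (2 * n + 1))"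
    using assms[unfolded solves_def, rule_format, of "2 * n"] by (simp add: alternating_kick_def)
  have 2: "x (2 * n + 3) = 2 * x (2 * n + 2) - x (2 * n + 1) + kick \<kappa>\<^sub>2 (x (2 * n + 2))"
    using assms[unfolded solves_def, rule_format, of "2 * n + 1"]
    by (simp add: alternating_kick_def numeral_3_eq_3)
  let ?a = "x (2 * n)" and ?b = "x (2 * n + 1)" and ?c = "x (2 * n + 2)" and ?d = "x (2 * n + 3)"
  have "two_kick_map \<kappa>\<^sub>1 \<kappa>\<^sub>2 (abs_circle ?b, ?b - ?a) = (abs_circle ?d, ?d - ?c)"
  proof -
    have y: "?b - ?a + kick \<kappa>\<^sub>1 ?b = ?c - ?b" "?c - ?b + kick \<kappa>\<^sub>2 ?c = ?d - ?c"
      using 1 2 by simp_all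
    have "?b + (?c - ?b) = ?c" "?c + (?d - ?c) = ?d"
      by simp_all
    with y show ?thesis
      by (simp only: two_kick_map_lift Let_def)
  qed
  moreover have "2 * Suc n + 1 = 2 * n + 3" "2 * Suc n = 2 * n + 2"
    by simp_all
  ultimately show ?case
    by (simp only: funpow.simps comp_apply Suc)
qed simp

lemma solution_exists:
  obtains x where "solves f x" "x 0 = a" "x 1 = b"
proof -
  define step where "step n = (\<lambda>(s, t). (t, 2 * t - s + f (n + 1) t))" for n
  define X where "X = rec_nat (a, b) step"
  define x where "x n = fst (X n)" for n
  have X: "X (Suc n) = (snd (X n), 2 * snd (X n) - x n + f (n + 1) (snd (X n)))" for n
    by (simp add: X_def step_def x_def split: prod.split)
  then have "x (Suc n) = snd (X n)" for n
    by (simp add: x_def)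
  then have "solves f x"
    using X by (simp add: solves_def)
  moreover have "x 0 = a" "x 1 = b"
    using X[of 0] by (simp_all add: x_def X_def)
  ultimately show ?thesis
    by (rule that)
qed

lemma solves_uminus:
  assumes "solves (alternating_kick \<kappa>\<^sub>1 \<kappa>\<^sub>2) x"
  shows "solves (alternating_kick \<kappa>\<^sub>1 \<kappa>\<^sub>2) (\<lambda>n. - x n)"
  unfolding solves_def
proof
  fix n
  show "- x n + - x (n + 2) - 2 * - x (n + 1) = alternating_kick \<kappa>\<^sub>1 \<kappa>\<^sub>2 (n + 1) (- x (n + 1))"
    using assms[unfolded solves_def, rule_format, of n]
    by (simp add: alternating_kick_def kick_uminus)
qed

section \<open>Accelerating barriers\<close>

text \<open>
  The copy \<open>q b\<close> of the rising piece, in its own time \<open>j\<close>, is \<open>p j\<close> plus the integer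
  \<open>b * j + c b\<close>; it is used at the times \<open>b * N + j\<close> with \<open>1 \<le> j \<le> N\<close>. The integer \<open>c b\<close> is the
  least one for which the copy starts at or above the end of its predecessor (\<open>before\<close>), hence less
  than 1 above it. The predecessor leaves that point with an increment at least 1 larger, so one
  step later it is at least as high (\<open>after\<close>). At every time the sequence \<open>v\<close> thus agrees
  with some \<open>q b\<close> and has neighbours that are at most those of the same \<open>q b\<close>, which makes it a
  supersolution. The same comparison bounds its increments from below.
\<close>

lemma accelerating_supersolution:
  fixes f :: "nat \<Rightarrow> real \<Rightarrow> real" and p :: "nat \<Rightarrow> real"
  assumes N: "N > 0" and f_period: "\<And>n s. f (n + N) s = f n s"
    and f_int: "\<And>n s k. f n (s + of_int k) = f n s"
    and p: "solves f p" and rise: "p (N + 1) - p N \<ge> p 1 - p 0 + 2"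
  obtains v and m :: int where "\<And>n. v n + v (n + 2) - 2 * v (n + 1) \<le> f (n + 1) (v (n + 1))"
    "\<And>n. real (n div N) - of_int m \<le> v (n + 1) - v n"
proof -
  define d where "d = \<lceil>p N - p 0\<rceil>"
  define c where "c b = (\<Sum>i<b. int (i * N) + d)" for b
  have c_Suc: "c (Suc b) = c b + int (b * N) + d" for b
    by (simp add: c_def)
  define q where "q b j = p j + of_int (int (b * j) + c b)" for b j
  \<comment> \<open>The block of time \<open>n\<close>; truncated subtraction puts time 0 into block 0.\<close>
  define B where "B n = (n - 1) div N" for n
  define v where "v n = q (B n) (n - B n * N)" for n
  have q_solves: "q b j + q b (j + 2) - 2 * q b (j + 1) = f (j + b' * N + 1) (q b (j + 1))" for b b' j
  proof -
    have "f (j + b' * N + 1) s = f (j + 1) s" for s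
    proof (induction b')
      case (Suc b')
      then show ?case using f_period[of "j + b' * N + 1" s] by (simp add: ac_simps)
    qed simp
    then show ?thesis
      using p[unfolded solves_def, rule_format, of j]
      by (simp only: q_def f_int) (simp add: algebra_simps)
  qed
  have before: "q b N \<le> q (Suc b) 0" for b
    using le_of_int_ceiling[of "p N - p 0"]
    by (simp add: q_def c_Suc d_def del: le_of_int_ceiling)
  have after: "q (Suc b) 1 \<le> q b (N + 1)" for b
    using rise of_int_ceiling_le_add_one[of "p N - p 0"]
    by (simp add: q_def c_Suc d_def algebra_simps)
  have v_block: "v (b * N + j + 1) = q b (j + 1)" if "j < N" for b j
    using that N by (simp add: v_def B_def)
  have v_left: "v (b * N + j) \<le> q b j" if "j < N" for b j
  proof (cases j)
    case 0
    show ?thesis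
    proof (cases b)
      case 0
      with \<open>j = 0\<close> show ?thesis by (simp add: v_def B_def)
    next
      case (Suc b')
      then show ?thesis
        using v_block[of "N - 1" b'] before[of b'] N \<open>j = 0\<close> by (simp add: add.commute)
    qed
  next
    case (Suc i)
    then show ?thesis using v_block[of i b] that by simp
  qed
  have v_right: "v (b * N + j + 2) \<le> q b (j + 2)" if "j < N" for b j
  proof (cases "j + 1 < N")
    case True
    then show ?thesis using v_block[of "j + 1" b] by simp
  next
    case False
    with that have j: "N = j + 1" by simp
    have "v (b * N + j + 2) = q (Suc b) 1"
      using v_block[of 0 "Suc b"] N j by (simp add: algebra_simps)
    then show ?thesis using after[of b] j by simp
  qed
  have super: "v n + v (n + 2) - 2 * v (n + 1) \<le> f (n + 1) (v (n + 1))" for n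
  proof -
    define b j where "b = n div N" and "j = n mod N"
    have j: "j < N" and n: "n = b * N + j"
      using N by (simp_all add: b_def j_def)
    have "v n + v (n + 2) - 2 * v (n + 1) \<le> q b j + q b (j + 2) - 2 * q b (j + 1)"
      unfolding n using v_left[OF j, of b] v_right[OF j, of b] v_block[OF j, of b] by simp
    also have "\<dots> = f (n + 1) (v (n + 1))"
      using q_solves[of b j b] v_block[OF j, of b] by (simp add: n ac_simps)
    finally show ?thesis .
  qed
  define M where "M = Max ((\<lambda>j. p j - p (j + 1)) ` {..<N})"
  have M: "p j - p (j + 1) \<le> M" if "j < N" for j
    unfolding M_def using that by (intro Max_ge) auto
  have speed: "real (n div N) - of_int \<lceil>M\<rceil> \<le> v (n + 1) - v n" for n
  proof -
    define b j where "b = n div N" and "j = n mod N"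
    have j: "j < N" and n: "n = b * N + j"
      using N by (simp_all add: b_def j_def)
    have "q b (j + 1) - q b j \<le> v (n + 1) - v n"
      using v_left[OF j, of b] v_block[OF j, of b] by (simp add: n)
    moreover have "q b (j + 1) - q b j = real b + (p (j + 1) - p j)"
      by (simp add: q_def algebra_simps)
    ultimately show ?thesis
      using M[OF j] le_of_int_ceiling[of M] unfolding b_def by linarith
  qed
  from super speed show ?thesis by (rule that)
qed

text \<open>
  Integer values make the kicks vanish, so the subsolution inequality reduces to convexity; the
  prescribed increments are nondecreasing integers.
\<close>

lemma accelerating_subsolution_below:
  fixes f :: "nat \<Rightarrow> real \<Rightarrow> real" and v :: "nat \<Rightarrow> real" and m :: int
  assumes f_zero: "\<And>n k. f n (of_int k) = 0"
    and speed: "\<And>n. real (n div N) - of_int m \<le> v (n + 1) - v n"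
  obtains u where "\<And>n. f (n + 1) (u (n + 1)) \<le> u n + u (n + 2) - 2 * u (n + 1)"
    "\<And>n. u n \<le> v n" "\<And>n. u (n + 1) - u n = real (n div N) - of_int m"
proof -
  define U where "U n = \<lfloor>v 0\<rfloor> + (\<Sum>i<n. int (i div N) - m)" for n
  define u where "u n = real_of_int (U n)" for n
  have step: "u (n + 1) - u n = real (n div N) - of_int m" for n
    by (simp add: u_def U_def)
  moreover have "u n \<le> v n" for n
  proof (induction n)
    case (Suc n)
    then show ?case using step[of n] speed[of n] by simp
  qed (simp add: u_def U_def)
  moreover have "f (n + 1) (u (n + 1)) \<le> u n + u (n + 2) - 2 * u (n + 1)" for n
  proof -
    have "real (n div N) \<le> real ((n + 1) div N)"
      by (simp only: of_nat_le_iff div_le_mono le_add1)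
    moreover have "f (n + 1) (u (n + 1)) = 0"
      by (simp add: u_def f_zero)
    ultimately show ?thesis
      using step[of n] step[of "n + 1"] unfolding add.assoc one_add_one by linarith
  qed
  ultimately show ?thesis by (blast intro: that)
qed

lemma not_linear_of_accelerating:
  fixes u :: "nat \<Rightarrow> real"
  assumes N: "N > 0" and step: "\<And>n. u (n + 1) - u n = real (n div N) - a"
  shows "\<exists>n. u n > A + C * real n"
proof -
  obtain k where k: "real k \<ge> a + C + 1"
    using real_arch_simple by blast
  \<comment> \<open>From block \<open>k\<close> on, every increment exceeds \<open>C\<close> by at least 1.\<close>
  have grow: "u (k * N + i) - C * real (k * N + i) \<ge> u (k * N) - C * real (k * N) + real i" for i
  proof (induction i)
    case (Suc i)
    have "k \<le> (k * N + i) div N"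
      using N by simp
    then have "u (k * N + i + 1) - u (k * N + i) \<ge> C + 1"
      using step[of "k * N + i"] k by (smt (verit) of_nat_mono)
    with Suc show ?case by (simp add: algebra_simps)
  qed simp
  obtain i where "real i > A - (u (k * N) - C * real (k * N))"
    using reals_Archimedean2 by blast
  with grow[of i] show ?thesis
    by (intro exI[of _ "k * N + i"]) linarith
qed

section \<open>Global transport\<close>

lemma global_transport_of_rise:
  assumes p: "solves (alternating_kick \<kappa>\<^sub>1 \<kappa>\<^sub>2) p"
    and rise: "p (2 * n + 1) - p (2 * n) > p 1 - p 0 + 2"
  shows "global_transport (two_kick_map \<kappa>\<^sub>1 \<kappa>\<^sub>2)"
proof -
  let ?f = "alternating_kick \<kappa>\<^sub>1 \<kappa>\<^sub>2"
  have N: "2 * n > 0"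
    using rise by (cases n) auto
  define L where "L = max \<bar>\<kappa>\<^sub>1\<bar> \<bar>\<kappa>\<^sub>2\<bar>"
  have kick_le: "\<bar>?f k s\<bar> \<le> L" for k s
    using abs_kick_le[of \<kappa>\<^sub>1 s] abs_kick_le[of \<kappa>\<^sub>2 s] by (auto simp: alternating_kick_def L_def)
  obtain v and m :: int
    where v: "\<And>k. v k + v (k + 2) - 2 * v (k + 1) \<le> ?f (k + 1) (v (k + 1))"
      and speed: "\<And>k. real (k div (2 * n)) - of_int m \<le> v (k + 1) - v k"
  proof (rule accelerating_supersolution[OF N _ _ p])
    show "?f (k + 2 * n) s = ?f k s" for k s
      by (simp add: alternating_kick_def)
    show "?f k (s + of_int i) = ?f k s" for k s i
      by (simp add: alternating_kick_def kick_add_int)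
  qed (use rise in auto)
  have "?f k (of_int i) = 0" for k i
    by (simp add: alternating_kick_def kick_int)
  from accelerating_subsolution_below[of ?f, OF this speed] obtain u
    where u: "\<And>k. ?f (k + 1) (u (k + 1)) \<le> u k + u (k + 2) - 2 * u (k + 1)"
      and uv: "\<And>k. u k \<le> v k"
      and u_step: "\<And>k. u (k + 1) - u k = real (k div (2 * n)) - of_int m"
    by blast
  have "mono (\<lambda>s. L * s - ?f k s)" for k
    by (auto simp: alternating_kick_def L_def intro!: mono_minus_kick)
  from solution_between[of L ?f, OF _ this u v uv] obtain x
    where x: "solves ?f x" and ux: "\<And>k. u k \<le> x k"
    unfolding L_def by (smt (verit) abs_ge_zero max.coboundedI1)
  show ?thesis
    unfolding global_transport_def
  proof (intro exI notI)
    assume "bounded (range (\<lambda>k. snd ((two_kick_map \<kappa>\<^sub>1 \<kappa>\<^sub>2 ^^ k) (abs_circle (x 1), x 1 - x 0))))"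
    then obtain C where C: "\<And>k. \<bar>x (2 * k + 1) - x (2 * k)\<bar> \<le> C"
      unfolding orbit_of_solution[OF x] by (auto simp: bounded_iff)
    \<comment> \<open>The orbit records the increments at even indices; a single kick leads to the odd ones.\<close>
    have slope: "x (k + 1) - x k \<le> C + L" for k
    proof (cases "even k")
      case True
      then show ?thesis
        using C[of "k div 2"] kick_le[of 0 0] by simp
    next
      case False
      then obtain i where i: "k = 2 * i + 1" by (rule oddE)
      show ?thesis
        using x[unfolded solves_def, rule_format, of "2 * i"] C[of i]
          kick_le[of "2 * i + 1" "x (2 * i + 1)"] by (simp add: i)
    qed
    have "x k \<le> x 0 + (C + L) * real k" for k
    proof (induction k)
      case (Suc k)
      then show ?case using slope[of k] by (simp add: algebra_simps)
    qed simp
    moreover obtain k where "u k > x 0 + (C + L) * real k"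
      using not_linear_of_accelerating[OF N u_step] by blast
    ultimately show False
      using ux[of k] by (smt (verit))
  qed
qed

theorem proposition1:
  fixes \<kappa>\<^sub>1 \<kappa>\<^sub>2 :: real
  assumes "\<exists>x\<^sub>0 y\<^sub>0. y\<^sub>0 \<in> {0<..<1} \<and>
             (\<exists>n. \<bar>snd ((two_kick_map \<kappa>\<^sub>1 \<kappa>\<^sub>2 ^^ n) (x\<^sub>0, y\<^sub>0)) - y\<^sub>0\<bar> > 2)"
    and "\<And>C. invariant_circle (two_kick_map \<kappa>\<^sub>1 \<kappa>\<^sub>2) C \<Longrightarrow> amplitude C < 1"
  shows "global_transport (two_kick_map \<kappa>\<^sub>1 \<kappa>\<^sub>2)"
proof -
  obtain x\<^sub>0 y\<^sub>0 n where far: "\<bar>snd ((two_kick_map \<kappa>\<^sub>1 \<kappa>\<^sub>2 ^^ n) (x\<^sub>0, y\<^sub>0)) - y\<^sub>0\<bar> > 2"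
    using assms(1) by blast
  obtain s where s: "x\<^sub>0 = abs_circle s"
    using circle.abs_induct[of "\<lambda>c. \<exists>s. c = abs_circle s"] by blast
  obtain p where p: "solves (alternating_kick \<kappa>\<^sub>1 \<kappa>\<^sub>2) p" and "p 0 = s - y\<^sub>0" "p 1 = s"
    by (rule solution_exists)
  then have "\<bar>(p (2 * n + 1) - p (2 * n)) - (p 1 - p 0)\<bar> > 2"
    using far orbit_of_solution[OF p, of n] by (simp add: s)
  \<comment> \<open>A falling momentum becomes a rising one under the reflection \<open>p \<mapsto> - p\<close>.\<close>
  then consider "p (2 * n + 1) - p (2 * n) > p 1 - p 0 + 2"
    | "- p (2 * n + 1) - - p (2 * n) > - p 1 - - p 0 + 2"
    by linarith
  then show ?thesis
    using global_transport_of_rise[OF p] global_transport_of_rise[OF solves_uminus[OF p]] by cases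
qed

end
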